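(* Let $A\in\mathbb{R}^{m\times n}$ with $2\le m<n$, let $b\in\mathbb{R}^m$, and let $k$ be an integer with $1\le k\le n$. Suppose that $A$ satisfies the following range property with this $k$: for any disjoint subsets $\Lambda_1,\Lambda_2$ of $\{1,\dots,n\}$ with $|\Lambda_1|+|\Lambda_2|=k$ and $|\Lambda_2|\le1$, the range space $\mathcal{R}(A^T)$ contains a vector $\eta$ satisfying $\eta_i=1$ for all $i\in\Lambda_1$, $\eta_i=-1$ for all $i\in\Lambda_2$, and $|\eta_i|<1$ for all $i\notin\Lambda_1\cup\Lambda_2$. Then if the system $Ax=b$ has a solution $x$ obeying $\|x\|_0\le k/2$, $x$ is the unique sparsest solution of the linear system.
   Context: $\mathcal{R}(A^T)\subseteq\mathbb{R}^n$ is the range (column space) of $A^T$. $\|x\|_0$ is the number of nonzero components of $x$. A solution $x$ of $Ax=b$ is the unique sparsest solution if $\|x\|_0<\|y\|_0$ for every solution $y\ne x$ of $Ay=b$. *)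

theory Defs
  imports "HOL-Analysis.Analysis"
begin

definition l0norm :: "real ^ 'n \<Rightarrow> nat" where
  "l0norm x = card {i. x $ i \<noteq> 0}"

definition range_space :: "real ^ 'n ^ 'm \<Rightarrow> (real ^ 'm) set" where
  "range_space M = range (\<lambda>u. M *v u)"

definition unique_sparsest_solution ::
    "real ^ 'n ^ 'm \<Rightarrow> real ^ 'm \<Rightarrow> real ^ 'n \<Rightarrow> bool" where
  "unique_sparsest_solution A b x \<longleftrightarrow>
     A *v x = b \<and> (\<forall>y. A *v y = b \<and> y \<noteq> x \<longrightarrow> l0norm x < l0norm y)"

text \<open>The coordinate set \<open>{1,\<dots>,n}\<close> is the finite index type \<^typ>\<open>'n\<close>.\<close>

definition range_property :: "nat \<Rightarrow> real ^ 'n ^ 'm \<Rightarrow> bool" where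
  "range_property k A \<longleftrightarrow>
     (\<forall>\<Lambda>1 \<Lambda>2 :: 'n set.
        \<Lambda>1 \<inter> \<Lambda>2 = {} \<and> card \<Lambda>1 + card \<Lambda>2 = k \<and> card \<Lambda>2 \<le> 1 \<longrightarrow>
        (\<exists>\<eta> \<in> range_space (transpose A).
           (\<forall>i \<in> \<Lambda>1. \<eta> $ i = 1) \<and>
           (\<forall>i \<in> \<Lambda>2. \<eta> $ i = - 1) \<and>
           (\<forall>i. i \<notin> \<Lambda>1 \<union> \<Lambda>2 \<longrightarrow> \<bar>\<eta> $ i\<bar> < 1)))"

end

theory Submission
  imports Defs
begin

text \<open>The range property forces any \<open>k\<close> columns of \<open>A\<close> to be linearly independent, and a solution
  supported on at most \<open>k / 2\<close> coordinates is then the only one that sparse: the difference of two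
  solutions is a null vector of \<open>A\<close>, whose support has more than \<open>k\<close> elements unless it is zero.

  For the independence, let \<open>z\<close> be a null vector of \<open>A\<close> supported in a set \<open>S\<close> of \<open>k\<close> coordinates.
  It is orthogonal to the range of the transpose. The range property, applied to the sign patterns
  on \<open>S\<close> with no minus sign and with a single minus sign at \<open>j\<close>, supplies two vectors of
  that range whose values on \<open>S\<close> differ only at \<open>j\<close>. Subtracting the two orthogonality relations
  leaves \<open>2 * z $ j = 0\<close>, for every \<open>j\<close> in \<open>S\<close>.\<close>

lemma range_space_transpose_orthogonal:
  fixes A :: "real ^ 'n ^ 'm"
  assumes "\<eta> \<in> range_space (transpose A)" and "A *v z = 0"
  shows "\<eta> \<bullet> z = 0"
  using assms by (auto simp: range_space_def dot_lmul_matrix)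

text \<open>With \<open>\<Lambda>2 = T\<close> and \<open>\<Lambda>1 = S - T\<close>, the orthogonality relation only sees the prescribed entries,
  because \<open>z\<close> vanishes wherever \<open>\<eta>\<close> is not prescribed.\<close>

lemma range_property_signed_sum_zero:
  fixes A :: "real ^ 'n ^ 'm"
  assumes "range_property (card S) A" and "A *v z = 0" and supp: "{i. z $ i \<noteq> 0} \<subseteq> S"
    and "T \<subseteq> S" and "card T \<le> 1"
  shows "(\<Sum>i\<in>S - T. z $ i) = (\<Sum>i\<in>T. z $ i)"
proof -
  have "(S - T) \<inter> T = {}" and "card (S - T) + card T = card S"
    using \<open>T \<subseteq> S\<close> by (auto simp: card_Diff_subset card_mono)
  then obtain \<eta> where \<eta>: "\<eta> \<in> range_space (transpose A)"
      "\<forall>i\<in>S - T. \<eta> $ i = 1" "\<forall>i\<in>T. \<eta> $ i = - 1"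
    using assms(1) \<open>card T \<le> 1\<close> unfolding range_property_def by meson
  have "0 = (\<Sum>i\<in>UNIV. \<eta> $ i * z $ i)"
    using range_space_transpose_orthogonal[OF \<eta>(1) assms(2)] by (simp add: inner_vec_def)
  also have "\<dots> = (\<Sum>i\<in>S. \<eta> $ i * z $ i)"
    by (rule sum.mono_neutral_right) (use supp in auto)
  also have "\<dots> = (\<Sum>i\<in>S - T. \<eta> $ i * z $ i) + (\<Sum>i\<in>T. \<eta> $ i * z $ i)"
    using \<open>T \<subseteq> S\<close> by (simp add: sum.subset_diff)
  also have "\<dots> = (\<Sum>i\<in>S - T. z $ i) - (\<Sum>i\<in>T. z $ i)"
    using \<eta>(2,3) by (simp add: sum_negf)
  finally show ?thesis by simp
qed

lemma range_property_null_vector_not_sparse: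
  fixes A :: "real ^ 'n ^ 'm"
  assumes "range_property k A" and "k \<le> CARD('n)" and "A *v z = 0" and "z \<noteq> 0"
  shows "k < l0norm z"
proof (rule ccontr)
  assume "\<not> k < l0norm z"
  \<comment> \<open>The range property speaks of exactly \<open>k\<close> indices, so the support is enlarged if necessary.\<close>
  then obtain S where S: "{i. z $ i \<noteq> 0} \<subseteq> S" "card S = k"
    using exists_subset_between[of "{i. z $ i \<noteq> 0}" k UNIV] \<open>k \<le> CARD('n)\<close>
    by (auto simp: l0norm_def)
  have "z $ j = 0" for j
  proof (cases "j \<in> S")
    case True
    have "(\<Sum>i\<in>S. z $ i) = 0"
      using range_property_signed_sum_zero[of S A z "{}"] assms(1,3) S by simp
    moreover have "(\<Sum>i\<in>S - {j}. z $ i) = z $ j"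
      using range_property_signed_sum_zero[of S A z "{j}"] assms(1,3) S True by simp
    moreover have "(\<Sum>i\<in>S. z $ i) = z $ j + (\<Sum>i\<in>S - {j}. z $ i)"
      using True by (simp add: sum.remove)
    ultimately show ?thesis by simp
  qed (use S in auto)
  then show False
    using \<open>z \<noteq> 0\<close> by (simp add: vec_eq_iff)
qed

lemma l0norm_diff_le: "l0norm (y - x) \<le> l0norm y + l0norm x"
proof -
  have "{i. (y - x) $ i \<noteq> 0} \<subseteq> {i. y $ i \<noteq> 0} \<union> {i. x $ i \<noteq> 0}"
    by auto
  then have "l0norm (y - x) \<le> card ({i. y $ i \<noteq> 0} \<union> {i. x $ i \<noteq> 0})"
    unfolding l0norm_def by (intro card_mono) auto
  also have "\<dots> \<le> l0norm y + l0norm x"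
    unfolding l0norm_def by (rule card_Un_le)
  finally show ?thesis .
qed

theorem theorem6p4:
  fixes A :: "real ^ 'n ^ 'm" and b :: "real ^ 'm" and x :: "real ^ 'n" and k :: nat
  assumes "2 \<le> CARD('m)" and "CARD('m) < CARD('n)"
    and "1 \<le> k" and "k \<le> CARD('n)"
    and "range_property k A"
    and "A *v x = b" and "real (l0norm x) \<le> real k / 2"
  shows "unique_sparsest_solution A b x"
  unfolding unique_sparsest_solution_def
proof (intro conjI allI impI)
  show "A *v x = b" by fact
next
  fix y
  assume y: "A *v y = b \<and> y \<noteq> x"
  then have "A *v (y - x) = 0" and "y - x \<noteq> 0"
    using \<open>A *v x = b\<close> by (simp_all add: matrix_vector_mult_diff_distrib)
  then have "k < l0norm (y - x)"
    using range_property_null_vector_not_sparse \<open>range_property k A\<close> \<open>k \<le> CARD('n)\<close> by blast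
  also have "\<dots> \<le> l0norm y + l0norm x"
    by (rule l0norm_diff_le)
  finally show "l0norm x < l0norm y"
    using \<open>real (l0norm x) \<le> real k / 2\<close> by linarith
qed

end
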